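(* Let $n \geq 4$ be an integer and let $\beta_{n-1} \in S_n$ be any $(n-1)$-cycle. Then for every integer $k$ with $0\le k\le n$, \[ c(k, \beta_{n-1})=(n-1)\binom{n-1}{k}C(k)+(n-1)^2\binom{n-3}{k-3}S(k-2). \]
   Context: $S_n$ is the group of permutations of $[n]=\{1,\dots,n\}$; products are composed right to left. The Hamming distance between $\sigma,\tau\in S_n$ is $H(\sigma,\tau)=|\{a\in[n]:\sigma(a)\neq\tau(a)\}|$. Two permutations $\alpha,\beta\in S_n$ $k$-commute if $H(\alpha\beta,\beta\alpha)=k$; $c(k,\beta)$ denotes the number of $\alpha\in S_n$ that $k$-commute with $\beta$. An $(n-1)$-cycle in $S_n$ is a permutation consisting of one cycle of length $n-1$ and one fixed point. For a permutation $\pi=p_1\dots p_j$ of $[j]$ in one-line notation, a succession is an index $i$ with $1\le i\le j-1$ and $p_{i+1}=p_i+1$; $S(j)$ denotes the number of permutations of $[j]$ with no succession (so $S(0)=S(1)=S(2)=1$). $C(k)$ denotes the number of cyclic permutations ($k$-cycles) $\sigma$ of $\{1,\dots,k\}$ such that $\sigma(i)\neq i+1 \bmod k$ for all $i$, using the convention $k \bmod k = k$; this is OEIS sequence A000757, with $C(0)=1$, $C(1)=C(2)=0$, $C(3)=1$. Binomial coefficients $\binom{a}{b}$ are $0$ when $b<0$ or $b>a$. *)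

theory Defs
  imports "HOL-Combinatorics.Cycles"
begin

text \<open>The elements of \<open>S\<^sub>n\<close> are the functions \<open>p\<close> with \<open>p permutes {1..n}\<close>, and the product
  \<open>\<sigma>\<tau>\<close> (composed right to left) is \<open>\<sigma> \<circ> \<tau>\<close>.\<close>

definition hamming :: "nat \<Rightarrow> (nat \<Rightarrow> nat) \<Rightarrow> (nat \<Rightarrow> nat) \<Rightarrow> nat" where
  "hamming n \<sigma> \<tau> = card {a \<in> {1..n}. \<sigma> a \<noteq> \<tau> a}"

definition k_commute :: "nat \<Rightarrow> nat \<Rightarrow> (nat \<Rightarrow> nat) \<Rightarrow> (nat \<Rightarrow> nat) \<Rightarrow> bool" where
  "k_commute n k \<alpha> \<beta> \<longleftrightarrow> hamming n (\<alpha> \<circ> \<beta>) (\<beta> \<circ> \<alpha>) = k"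

definition k_commute_count :: "nat \<Rightarrow> nat \<Rightarrow> (nat \<Rightarrow> nat) \<Rightarrow> nat" where
  "k_commute_count n k \<beta> = card {\<alpha>. \<alpha> permutes {1..n} \<and> k_commute n k \<alpha> \<beta>}"

text \<open>\<open>is_cycle n m \<sigma>\<close>: \<open>\<sigma> \<in> S\<^sub>n\<close> is an \<open>m\<close>-cycle; as \<^const>\<open>cycle_of_list\<close> is the identity outside
  the list, the remaining \<open>n - m\<close> points are fixed.\<close>

definition is_cycle :: "nat \<Rightarrow> nat \<Rightarrow> (nat \<Rightarrow> nat) \<Rightarrow> bool" where
  "is_cycle n m \<sigma> \<longleftrightarrow>
     (\<exists>cs. distinct cs \<and> set cs \<subseteq> {1..n} \<and> length cs = m \<and> \<sigma> = cycle_of_list cs)"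

lemma is_cycle_permutes: "is_cycle n m \<sigma> \<Longrightarrow> \<sigma> permutes {1..n}"
  unfolding is_cycle_def using cycle_permutes permutes_subset by blast

definition succession_free_count :: "nat \<Rightarrow> nat" where
  "succession_free_count j =
     card {p. p permutes {1..j} \<and> \<not> (\<exists>i. 1 \<le> i \<and> i < j \<and> p (i + 1) = p i + 1)}"

text \<open>OEIS A000757. For \<open>1 \<le> i \<le> k\<close> the number \<open>i mod k + 1\<close> is the representative of
  \<open>i + 1\<close> modulo \<open>k\<close> in \<open>{1..k}\<close>, that is, \<open>i + 1 mod k\<close> under the convention \<open>k mod k = k\<close>.
  The empty list makes the identity count as the only \<open>0\<close>-cycle, which gives the
  conventional value \<open>1\<close> at \<open>k = 0\<close>.\<close>

definition cyclic_succession_free_count :: "nat \<Rightarrow> nat" where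
  "cyclic_succession_free_count k =
     card {\<sigma>. is_cycle k k \<sigma> \<and> (\<forall>i\<in>{1..k}. \<sigma> i \<noteq> i mod k + 1)}"

lemma cyclic_succession_free_count_0: "cyclic_succession_free_count 0 = 1"
proof -
  have "{\<sigma>. is_cycle 0 0 \<sigma> \<and> (\<forall>i\<in>{1..0}. \<sigma> i \<noteq> i mod 0 + 1)} = {id}"
    by (auto simp: is_cycle_def)
  then show ?thesis by (simp add: cyclic_succession_free_count_def)
qed

lemma cyclic_succession_free_count_1: "cyclic_succession_free_count 1 = 0"
proof -
  have "\<sigma> 1 = 1" if "is_cycle 1 1 \<sigma>" for \<sigma>
    using permutes_in_image[OF is_cycle_permutes[OF that], of 1] by simp
  then have "{\<sigma>. is_cycle 1 1 \<sigma> \<and> (\<forall>i\<in>{1..1}. \<sigma> i \<noteq> i mod 1 + 1)} = {}"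
    by auto
  then show ?thesis unfolding cyclic_succession_free_count_def by (metis card.empty)
qed

lemma succession_free_count_0: "succession_free_count 0 = 1"
  by (simp add: succession_free_count_def)

text \<open>Binomial coefficient with integer arguments, \<open>0\<close> when \<open>b < 0\<close> or \<open>b > a\<close>.\<close>

definition int_binomial :: "int \<Rightarrow> int \<Rightarrow> nat" where
  "int_binomial a b = (if b < 0 \<or> b > a then 0 else nat a choose nat b)"

end

theory Submission
  imports Defs
begin

text \<open>Let \<open>\<beta>\<close> be cyclic on \<open>X\<close>, with one further fixed point \<open>f\<close>. A permutation \<open>\<alpha>\<close> of \<open>X\<close> is
  determined by the value \<open>\<alpha> q\<close> at a point \<open>q\<close> and by the cyclic permutation
  \<open>\<sigma> = \<alpha> \<beta> \<alpha>\<inverse>\<close> of \<open>X\<close>, and \<open>\<alpha>\<close> and \<open>\<beta>\<close> commute at \<open>a\<close> iff \<open>\<sigma>\<close> and \<open>\<beta>\<close> agree at \<open>\<alpha> a\<close>. If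
  \<open>\<alpha> f = f\<close>, this reduces the count to cyclic \<open>\<sigma>\<close> with a given number of agreements with \<open>\<beta>\<close> on \<open>X\<close>.
  If \<open>\<alpha> f = p \<noteq> f\<close> and \<open>\<alpha> q = f\<close>, removing \<open>f\<close> from the cycle of \<open>\<alpha>\<close> gives a permutation of \<open>X\<close> that maps
  \<open>q\<close> to \<open>p\<close>, and agreements are then counted on \<open>X - {p, \<beta>\<inverse> p}\<close> only.

  The number of cyclic permutations that agree with \<open>\<beta>\<close> on \<open>A\<close> is \<open>(card X - card A - 1)!\<close>, so by
  inclusion-exclusion the number that agree on \<open>A\<close> and disagree on \<open>B\<close> depends only on \<open>card X - card A\<close>
  and \<open>card B\<close>. The numbers $C(k)$ and $S(j)$ are instances of the same count.\<close>

subsection \<open>Cyclic permutations with prescribed values\<close>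

text \<open>Transitivity, instead of a list of points, suits orbit arguments on an arbitrary set;
  \<open>is_cycle_iff\<close> links the two views. On the empty set only the identity remains, in
  accordance with $C(0)=1$.\<close>

definition cyclic_perms :: "'a set \<Rightarrow> ('a \<Rightarrow> 'a) set" where
  "cyclic_perms X = {\<sigma>. \<sigma> permutes X \<and> (\<forall>a\<in>X. \<forall>b\<in>X. \<exists>i. (\<sigma> ^^ i) a = b)}"

lemma cyclic_permsI:
  assumes "\<sigma> permutes X" "\<And>a b. a \<in> X \<Longrightarrow> b \<in> X \<Longrightarrow> \<exists>i. (\<sigma> ^^ i) a = b"
  shows "\<sigma> \<in> cyclic_perms X"
  using assms by (auto simp: cyclic_perms_def)

lemma cyclic_perms_permutes: "\<sigma> \<in> cyclic_perms X \<Longrightarrow> \<sigma> permutes X"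
  by (simp add: cyclic_perms_def)

lemma cyclic_perms_reach:
  "\<sigma> \<in> cyclic_perms X \<Longrightarrow> a \<in> X \<Longrightarrow> b \<in> X \<Longrightarrow> \<exists>i. (\<sigma> ^^ i) a = b"
  by (simp add: cyclic_perms_def)

lemma finite_cyclic_perms: "finite X \<Longrightarrow> finite (cyclic_perms X)"
  by (rule finite_subset[OF _ finite_permutations[of X]]) (auto simp: cyclic_perms_def)

text \<open>The orbit of \<open>a\<close> stays in \<open>S\<close> and is all of \<open>X\<close>.
  It serves to show that a property closed under \<sigma> holds throughout \<open>X\<close>.\<close>

lemma cyclic_perms_invariant_subset:
  assumes \<sigma>: "\<sigma> \<in> cyclic_perms X" and a: "a \<in> X" "a \<in> S" and "\<And>z. z \<in> S \<Longrightarrow> \<sigma> z \<in> S"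
  shows "X \<subseteq> S"
proof
  fix b assume "b \<in> X"
  then obtain i where i: "(\<sigma> ^^ i) a = b" using cyclic_perms_reach[OF \<sigma>] a by blast
  have "(\<sigma> ^^ i) a \<in> S" for i
    by (induction i) (use assms in auto)
  then show "b \<in> S" using i by blast
qed

lemma cyclic_perms_empty: "cyclic_perms {} = {id}"
  by (auto simp: cyclic_perms_def)

lemma cyclic_perms_no_fixpoint:
  assumes "\<sigma> \<in> cyclic_perms X" "x \<in> X" "finite X" "card X \<ge> 2"
  shows "\<sigma> x \<noteq> x"
proof
  assume "\<sigma> x = x"
  then have "X \<subseteq> {x}"
    using cyclic_perms_invariant_subset[OF assms(1,2), of "{x}"] by simp
  then have "card X \<le> 1" using card_mono[of "{x}" X] by simp
  with assms(4) show False by simp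
qed

lemma permutes_eqI:
  assumes "\<sigma> permutes X" "\<tau> permutes X" "\<And>x. x \<in> X \<Longrightarrow> \<sigma> x = \<tau> x"
  shows "\<sigma> = \<tau>"
  using assms by (metis ext permutes_def)

text \<open>A cycle inside the graph of \<sigma> is closed under \<sigma>, hence passes through all
  of \<open>X\<close> and uses at least \<open>card X\<close> pairs.\<close>

lemma acyclic_subset_of_cyclic_perm:
  assumes \<sigma>: "\<sigma> \<in> cyclic_perms X" and "finite X" and S: "S \<subseteq> X \<times> X"
    and Sg: "\<And>x y. (x, y) \<in> S \<Longrightarrow> \<sigma> x = y" and "card S < card X"
  shows "acyclic S"
proof (rule ccontr)
  have finS: "finite S" using finite_subset[OF S] assms(2) by simp
  have sv: "y = y'" if "(x, y) \<in> S" "(x, y') \<in> S" for x y y' using Sg that by metis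
  assume "\<not> acyclic S"
  then obtain a where a: "(a, a) \<in> S\<^sup>+" by (auto simp: acyclic_def)
  \<comment> \<open>\<open>S\<close> is single-valued, so a walk from \<open>a\<close> cannot leave
    the cycle: every point reached still leads back to \<open>a\<close>, and in particular has a
    successor.\<close>
  have to_a: "(z, a) \<in> S\<^sup>+" if "(a, z) \<in> S\<^sup>*" for z
    using that
  proof (induction rule: rtrancl_induct)
    case base show ?case by (rule a)
  next
    case (step y z)
    from step.IH obtain y' where y': "(y, y') \<in> S" "(y', a) \<in> S\<^sup>*" by (meson tranclD)
    with step sv have "(z, a) \<in> S\<^sup>*" by metis
    then show ?case using a by (rule rtrancl_trancl_trancl)
  qed
  have dom: "z \<in> Domain S" if "(a, z) \<in> S\<^sup>*" for z
    using to_a[OF that] by (meson Domain.DomainI tranclD)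
  have "a \<in> X" using dom S by blast
  have "X \<subseteq> {z. (a, z) \<in> S\<^sup>*}"
  proof (rule cyclic_perms_invariant_subset[OF \<sigma> \<open>a \<in> X\<close>])
    fix z assume z: "z \<in> {z. (a, z) \<in> S\<^sup>*}"
    then obtain z' where "(z, z') \<in> S" using dom by blast
    then show "\<sigma> z \<in> {z. (a, z) \<in> S\<^sup>*}" using Sg z by (metis mem_Collect_eq rtrancl.rtrancl_into_rtrancl)
  qed simp
  then have "X \<subseteq> Domain S" using dom by blast
  then have "card X \<le> card (Domain S)" by (intro card_mono) (use finS finite_Domain in auto)
  also have "\<dots> \<le> card S"
    unfolding Domain_fst using card_image_le[OF finS] .
  finally show False using assms(5) by simp
qed

section \<open>Start points of paths in a finite acyclic relation\<close>

lemma ex_source: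
  assumes "finite R" "acyclic R"
  shows "\<exists>y. y \<notin> Range R \<and> (y, x) \<in> R\<^sup>*"
proof -
  \<comment> \<open>Walking backwards from \<open>x\<close> must stop; a minimal element among the
    ancestors of \<open>x\<close> has no predecessor.\<close>
  have "wf R" using finite_acyclic_wf assms by blast
  moreover have "x \<in> {y. (y, x) \<in> R\<^sup>*}" by simp
  ultimately obtain y where "y \<in> {y. (y, x) \<in> R\<^sup>*}"
    and "\<And>z. (z, y) \<in> R \<Longrightarrow> z \<notin> {y. (y, x) \<in> R\<^sup>*}"
    by (rule wfE_min) blast
  then have y: "(y, x) \<in> R\<^sup>*" "\<And>z. (z, y) \<in> R \<Longrightarrow> (z, x) \<notin> R\<^sup>*" by simp_all
  then show ?thesis by (meson RangeE converse_rtrancl_into_rtrancl)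
qed

text \<open>Backward walks are deterministic, so two ancestors of \<open>x\<close> are comparable,
  and comparable points without predecessors coincide.\<close>

lemma source_unique:
  assumes sv: "single_valued (R\<inverse>)" and "(y, x) \<in> R\<^sup>*" "(z, x) \<in> R\<^sup>*" "y \<notin> Range R" "z \<notin> Range R"
  shows "y = z"
proof -
  have "(x, y) \<in> (R\<inverse>)\<^sup>*" "(x, z) \<in> (R\<inverse>)\<^sup>*" using assms(2,3) by (simp_all add: rtrancl_converse)
  from single_valued_confluent[OF sv this] have "(z, y) \<in> R\<^sup>* \<or> (y, z) \<in> R\<^sup>*"
    by (simp add: rtrancl_converse)
  then show ?thesis using assms(4,5) by (metis Range.intros rtranclE)
qed

text \<open>The prescribed values form a relation and not a partial function, so that its paths can
  be followed with \<open>R\<^sup>*\<close>; when it is injective and acyclic, it is a disjoint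
  union of paths.\<close>

definition cyclic_extensions :: "'a set \<Rightarrow> ('a \<times> 'a) set \<Rightarrow> ('a \<Rightarrow> 'a) set" where
  "cyclic_extensions X R = {\<sigma> \<in> cyclic_perms X. \<forall>(x, y)\<in>R. \<sigma> x = y}"

lemma card_Domain_single_valued:
  assumes "single_valued R" shows "card (Domain R) = card R"
  unfolding Domain_fst using assms
  by (intro card_image) (auto simp: inj_on_def single_valued_def)

lemma card_Range_single_valued:
  assumes "single_valued (R\<inverse>)" shows "card (Range R) = card R"
  using card_Domain_single_valued[OF assms] by (simp add: card_inverse)

text \<open>With one end point \<open>x\<close> and one start point \<open>y\<close>, the relation
  is a single path through \<open>X\<close>, and the only way to complete it is to close it by
  sending \<open>x\<close> to \<open>y\<close>.\<close>

lemma cyclic_extension_hamiltonian_path: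
  assumes fin: "finite X" and R: "R \<subseteq> X \<times> X" and sv: "single_valued R" and inj: "single_valued (R\<inverse>)"
    and ac: "acyclic R" and x: "X - Domain R = {x}" and y: "X - Range R = {y}"
  shows "\<exists>\<sigma>. cyclic_extensions X R = {\<sigma>}"
proof -
  have finR: "finite R" using finite_subset[OF R] fin by simp
  define \<sigma> where "\<sigma> z = (if z = x then y else if z \<in> X then THE w. (z, w) \<in> R else z)" for z
  have R_\<sigma>: "\<sigma> u = v" if "(u, v) \<in> R" for u v
  proof -
    have "u \<noteq> x" "u \<in> X" using x that R by auto
    moreover have "(THE w. (u, w) \<in> R) = v" using that sv by (auto simp: single_valued_def)
    ultimately show ?thesis by (simp add: \<sigma>_def)
  qed
  have \<sigma>_R: "(u, \<sigma> u) \<in> R" if "u \<in> X" "u \<noteq> x" for u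
    using R_\<sigma> that x by blast
  have xX: "x \<in> X" "y \<in> X" using x y by auto
  have sink: "u = x" if "u \<in> X" "u \<notin> Domain R" for u
    using that x by (metis Diff_iff singletonD)
  have source: "u = y" if "u \<in> X" "u \<notin> Range R" for u
    using that y by (metis Diff_iff singletonD)
  have "inj_on \<sigma> X"
  proof (rule inj_onI)
    fix u v assume uv: "u \<in> X" "v \<in> X" "\<sigma> u = \<sigma> v"
    have yR: "y \<notin> Range R" using y by auto
    have "\<sigma> x = y" by (simp add: \<sigma>_def)
    then consider "u = x" "v = x" | "u \<noteq> x" "v \<noteq> x" using \<sigma>_R uv yR by (metis Range.intros)
    then show "u = v"
    proof cases
      case 2 then show ?thesis using \<sigma>_R uv inj by (metis converse_iff single_valuedD)
    qed simp
  qed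
  moreover have "\<sigma> ` X \<subseteq> X"
    using \<sigma>_R R xX by (auto simp: \<sigma>_def[of x]) (metis \<sigma>_def mem_Sigma_iff subsetD)
  ultimately have "bij_betw \<sigma> X X"
    using fin by (metis bij_betw_def endo_inj_surj)
  then have perm: "\<sigma> permutes X"
    by (rule bij_imp_permutes) (use xX in \<open>auto simp: \<sigma>_def\<close>)
  have pow: "\<exists>i. (\<sigma> ^^ i) u = v" if "(u, v) \<in> R\<^sup>*" for u v
    using that
  proof (induction rule: rtrancl_induct)
    case base show ?case by (rule exI[of _ 0]) simp
  next
    case (step v w)
    then obtain i where "(\<sigma> ^^ i) u = v" by blast
    then have "(\<sigma> ^^ Suc i) u = w" using R_\<sigma>[OF step(2)] by simp
    then show ?case by blast
  qed
  have inX: "u \<in> X" if "(u, v) \<in> R\<^sup>*" "v \<in> X" for u v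
    using that by (induction rule: rtrancl_induct) (use R in auto)
  have inX': "v \<in> X" if "(u, v) \<in> R\<^sup>*" "u \<in> X" for u v
    using that by (induction rule: rtrancl_induct) (use R in auto)
  have "\<sigma> \<in> cyclic_perms X"
  proof (rule cyclic_permsI[OF perm])
    fix a b assume ab: "a \<in> X" "b \<in> X"
    \<comment> \<open>Going back from \<open>b\<close> leads to \<open>y\<close>, and going forward
      from \<open>a\<close> leads to \<open>x\<close>. The walk from \<open>a\<close> to
      \<open>b\<close> joins these two pieces by the closing step from \<open>x\<close> to
      \<open>y\<close>, which accounts for the \<open>Suc\<close> in the exponent.\<close>
    obtain s where "s \<notin> Range R" "(s, b) \<in> R\<^sup>*" using ex_source[OF finR ac] by blast
    then have "(y, b) \<in> R\<^sup>*" using inX ab source by metis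
    obtain t where "t \<notin> Range (R\<inverse>)" "(t, a) \<in> (R\<inverse>)\<^sup>*"
      using ex_source[of "R\<inverse>"] finR ac by auto
    then have "(a, t) \<in> R\<^sup>*" "t \<notin> Domain R" by (auto simp: rtrancl_converse)
    then have "(a, x) \<in> R\<^sup>*" using inX' ab sink by metis
    then obtain i where i: "(\<sigma> ^^ i) a = x" using pow by blast
    obtain j where j: "(\<sigma> ^^ j) y = b" using pow \<open>(y, b) \<in> R\<^sup>*\<close> by blast
    have "(\<sigma> ^^ (j + Suc i)) a = b"
      unfolding funpow_add using i j by (simp add: \<sigma>_def[of x])
    then show "\<exists>i. (\<sigma> ^^ i) a = b" by blast
  qed
  then have mem: "\<sigma> \<in> cyclic_extensions X R"
    using R_\<sigma> by (auto simp: cyclic_extensions_def)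
  have "\<tau> = \<sigma>" if \<tau>: "\<tau> \<in> cyclic_extensions X R" for \<tau>
  proof -
    have \<tau>R: "\<tau> u = v" if "(u, v) \<in> R" for u v using that \<tau> by (auto simp: cyclic_extensions_def)
    have \<tau>p: "\<tau> permutes X" using \<tau> by (auto simp: cyclic_extensions_def cyclic_perms_permutes)
    \<comment> \<open>Injectivity forbids reusing a value taken elsewhere, so the only value left
      for \<open>x\<close> is \<open>y\<close>.\<close>
    have "\<tau> x \<notin> Range R"
    proof
      assume "\<tau> x \<in> Range R"
      then obtain u where u: "(u, \<tau> x) \<in> R" by blast
      then have "u = x" using \<tau>R permutes_inj[OF \<tau>p] by (meson injD)
      then show False using u x by blast
    qed
    then have "\<tau> x = y" using permutes_in_image[OF \<tau>p] xX source by metis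
    then have "\<tau> u = \<sigma> u" if "u \<in> X" for u
      using \<sigma>_R \<tau>R that by (cases "u = x") (auto simp: \<sigma>_def[of x])
    then show ?thesis by (rule permutes_eqI[OF \<tau>p perm])
  qed
  with mem show ?thesis by blast
qed

text \<open>An end point \<open>x\<close> of a path of \<open>R\<close> can be sent to the start of any path other than its
  own; this gives \<open>card X - card R - 1\<close> relations with one more pair.\<close>

lemma card_cyclic_extensions:
  assumes fin: "finite X" and "R \<subseteq> X \<times> X" and "single_valued R" and "single_valued (R\<inverse>)"
    and "acyclic R" and "X \<noteq> {}"
  shows "card (cyclic_extensions X R) = fact (card X - card R - 1)"
  using assms(2-5)
proof (induction "card X - card R" arbitrary: R rule: less_induct)
  case less
  note R = less.prems(1) and sv = less.prems(2) and inj = less.prems(3) and ac = less.prems(4)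
  have finR: "finite R" using finite_subset[OF R] fin by simp
  have DX: "Domain R \<subseteq> X" and RX: "Range R \<subseteq> X" using R by auto
  have cD: "card (X - Domain R) = card X - card R"
    using card_Diff_subset[OF finite_subset[OF DX fin] DX] card_Domain_single_valued[OF sv] by simp
  have cR: "card (X - Range R) = card X - card R"
    using card_Diff_subset[OF finite_subset[OF RX fin] RX] card_Range_single_valued[OF inj] by simp
  \<comment> \<open>Otherwise every point of \<open>X\<close> would have a predecessor, although a
    finite acyclic relation has start points.\<close>
  have lt: "card R < card X"
  proof (rule ccontr)
    assume "\<not> card R < card X"
    then have "X - Range R = {}" using cR fin by simp
    moreover obtain x where "x \<in> X" using assms(6) by blast
    moreover obtain y where "y \<notin> Range R" "(y, x) \<in> R\<^sup>*" using ex_source[OF finR ac] by blast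
    ultimately show False using R by (metis Diff_iff Domain.DomainI DX converse_rtranclE empty_iff subsetD)
  qed
  show ?case
  proof (cases "card X - card R = 1")
    case True
    then obtain x y where "X - Domain R = {x}" "X - Range R = {y}"
      using cD cR by (metis card_1_singletonE)
    from cyclic_extension_hamiltonian_path[OF fin R sv inj ac this] True show ?thesis by auto
  next
    case False
    then have ge2: "card R + 2 \<le> card X" using lt by simp
    have "X - Domain R \<noteq> {}" using cD lt by (metis card.empty zero_less_diff less_irrefl)
    then obtain x where x: "x \<in> X" "x \<notin> Domain R" by blast
    define Y where "Y = {y \<in> X - Range R. (y, x) \<notin> R\<^sup>*}"
    obtain s where s: "s \<notin> Range R" "(s, x) \<in> R\<^sup>*" using ex_source[OF finR ac] by blast
    have sX: "s \<in> X" using s x R by (metis Domain.DomainI DX converse_rtranclE subsetD)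
    have "Y = (X - Range R) - {s}"
      unfolding Y_def using s source_unique[OF inj s(2) _ s(1)] by (intro set_eqI) (metis (no_types, lifting) Diff_iff mem_Collect_eq singleton_iff)
    then have cY: "card Y = card X - card R - 1"
      using cR s sX by simp
    have finY: "finite Y" unfolding Y_def using fin by simp
    have notin: "(x, y) \<notin> R" for y using x by blast
    have split: "cyclic_extensions X R = (\<Union>y\<in>Y. cyclic_extensions X (insert (x, y) R))"
    proof (intro equalityI subsetI)
      fix \<sigma> assume \<sigma>: "\<sigma> \<in> cyclic_extensions X R"
      then have \<sigma>c: "\<sigma> \<in> cyclic_perms X" and \<sigma>R: "\<And>u v. (u, v) \<in> R \<Longrightarrow> \<sigma> u = v"
        by (auto simp: cyclic_extensions_def)
      note p = cyclic_perms_permutes[OF \<sigma>c]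
      have X': "\<sigma> x \<in> X" using x permutes_in_image[OF p] by simp
      have "\<sigma> x \<notin> Range R"
      proof
        assume "\<sigma> x \<in> Range R"
        then obtain u where u: "(u, \<sigma> x) \<in> R" by blast
        then have "u = x" using \<sigma>R permutes_inj[OF p] by (meson injD)
        then show False using u x by blast
      qed
      \<comment> \<open>By \<open>ge2\<close> the enlarged relation still has fewer than
        \<open>card X\<close> pairs, too few for a cycle inside the graph of \<sigma>; so \<sigma>
        cannot send \<open>x\<close> to the start of its own path.\<close>
      moreover have "acyclic (insert (x, \<sigma> x) R)"
        by (rule acyclic_subset_of_cyclic_perm[OF \<sigma>c fin])
          (use R x X' \<sigma>R finR ge2 notin in \<open>auto simp: card_insert_if\<close>)
      ultimately have "\<sigma> x \<in> Y" using X' by (simp add: Y_def)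
      moreover have "\<sigma> \<in> cyclic_extensions X (insert (x, \<sigma> x) R)"
        using \<sigma> by (simp add: cyclic_extensions_def)
      ultimately show "\<sigma> \<in> (\<Union>y\<in>Y. cyclic_extensions X (insert (x, y) R))" by blast
    qed (auto simp: cyclic_extensions_def)
    have step: "card (cyclic_extensions X (insert (x, y) R)) = fact (card X - card R - 2)" if "y \<in> Y" for y
    proof -
      have ci: "card (insert (x, y) R) = Suc (card R)" using finR notin by simp
      have "card (cyclic_extensions X (insert (x, y) R)) = fact (card X - card (insert (x, y) R) - 1)"
      proof (rule less.hyps)
        show "card X - card (insert (x, y) R) < card X - card R" using ci lt by simp
        show "insert (x, y) R \<subseteq> X \<times> X" using R x that by (auto simp: Y_def)
        show "single_valued (insert (x, y) R)" using sv notin by (auto simp: single_valued_def)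
        show "single_valued ((insert (x, y) R)\<inverse>)"
          using inj that by (auto simp: single_valued_def Y_def)
        show "acyclic (insert (x, y) R)" using ac that by (auto simp: Y_def)
      qed
      then show ?thesis by (simp add: ci)
    qed
    have "card (cyclic_extensions X R) = (\<Sum>y\<in>Y. card (cyclic_extensions X (insert (x, y) R)))"
      unfolding split
    proof (rule card_UN_disjoint[OF finY])
      show "\<forall>y\<in>Y. finite (cyclic_extensions X (insert (x, y) R))"
        using finite_cyclic_perms[OF fin] by (simp add: cyclic_extensions_def)
    qed (auto simp: cyclic_extensions_def)
    also have "\<dots> = (card X - card R - 1) * fact (card X - card R - 2)"
      using step cY by simp
    also have "\<dots> = fact (card X - card R - 1)"
      using ge2 by (subst (2) fact_reduce) (auto simp: numeral_2_eq_2)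
    finally show ?thesis .
  qed
qed

subsection \<open>Agreements and disagreements with a cyclic permutation\<close>

text \<open>\<open>avoid_count a b\<close> is the number of cyclic permutations that differ from a given one at
  \<open>b\<close> specified points, when their values are prescribed at all but \<open>a\<close> of the points. Truncated
  subtraction makes \<open>avoid_count 0 0 = 1\<close>, the case where every value is prescribed.\<close>

fun avoid_count :: "nat \<Rightarrow> nat \<Rightarrow> nat" where
  "avoid_count a 0 = fact (a - 1)"
| "avoid_count a (Suc b) = avoid_count a b - avoid_count (a - 1) b"

lemma card_agree:
  assumes fin: "finite X" and \<beta>: "\<beta> \<in> cyclic_perms X" and A: "A \<subseteq> X"
  shows "card {\<sigma> \<in> cyclic_perms X. \<forall>x\<in>A. \<sigma> x = \<beta> x} = fact (card X - card A - 1)"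
\<comment> \<open>If all values are prescribed, the graph of \<beta> is a closed cycle and not a
  union of paths unless \<open>X\<close> is empty; only \<beta> qualifies, and truncated subtraction
  gives \<open>fact 0\<close>.\<close>
proof (cases "A = X")
  case True
  have "{\<sigma> \<in> cyclic_perms X. \<forall>x\<in>A. \<sigma> x = \<beta> x} = {\<beta>}"
    using \<beta> True by (auto intro!: permutes_eqI[of _ X] cyclic_perms_permutes)
  then show ?thesis using True by simp
next
  case False
  note p = cyclic_perms_permutes[OF \<beta>]
  define R where "R = (\<lambda>x. (x, \<beta> x)) ` A"
  have cR: "card R = card A"
    unfolding R_def by (rule card_image) (auto simp: inj_on_def)
  have RX: "R \<subseteq> X \<times> X" using A permutes_in_image[OF p] by (auto simp: R_def)
  have "{\<sigma> \<in> cyclic_perms X. \<forall>x\<in>A. \<sigma> x = \<beta> x} = cyclic_extensions X R"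
    by (auto simp: cyclic_extensions_def R_def)
  also have "card \<dots> = fact (card X - card R - 1)"
  proof (rule card_cyclic_extensions[OF fin RX])
    show "acyclic R"
    proof (rule acyclic_subset_of_cyclic_perm[OF \<beta> fin RX])
      show "card R < card X" using cR False A fin by (simp add: psubset_card_mono psubset_eq)
    qed (auto simp: R_def)
    show "single_valued (R\<inverse>)"
      using permutes_inj[OF p] by (auto simp: single_valued_def R_def inj_def)
  qed (use False A in \<open>auto simp: single_valued_def R_def\<close>)
  finally show ?thesis by (simp add: cR)
qed

text \<open>Imposing disagreement at a further point \<open>x\<close> removes the permutations that
  agree at \<open>x\<close>, for which \<open>x\<close> joins \<open>A\<close>. This is the
  recursion of \<open>avoid_count\<close>, and it is why \<open>A\<close> varies in the
  induction.\<close>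

lemma card_agree_disagree:
  assumes fin: "finite X" and \<beta>: "\<beta> \<in> cyclic_perms X" and "finite B" "A \<subseteq> X" "B \<subseteq> X" "A \<inter> B = {}"
  shows "card {\<sigma> \<in> cyclic_perms X. (\<forall>x\<in>A. \<sigma> x = \<beta> x) \<and> (\<forall>x\<in>B. \<sigma> x \<noteq> \<beta> x)}
    = avoid_count (card X - card A) (card B)"
  using assms(3-)
proof (induction B arbitrary: A rule: finite_induct)
  case empty
  then show ?case using card_agree[OF fin \<beta>] by simp
next
  case (insert x B)
  let ?W = "\<lambda>A B. {\<sigma> \<in> cyclic_perms X. (\<forall>x\<in>A. \<sigma> x = \<beta> x) \<and> (\<forall>x\<in>B. \<sigma> x \<noteq> \<beta> x)}"
  have "?W A (insert x B) = ?W A B - ?W (insert x A) B" by auto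
  moreover have "card (?W A B - ?W (insert x A) B) = card (?W A B) - card (?W (insert x A) B)"
    by (rule card_Diff_subset) (use finite_cyclic_perms[OF fin] in auto)
  moreover have "card (?W A B) = avoid_count (card X - card A) (card B)"
    by (rule insert.IH) (use insert.prems in auto)
  moreover have "card (?W (insert x A) B) = avoid_count (card X - card (insert x A)) (card B)"
    by (rule insert.IH) (use insert in auto)
  moreover have "card (insert x A) = Suc (card A)"
    using insert.prems finite_subset[OF _ fin, of A] by auto
  ultimately show ?case using insert.hyps by simp
qed

text \<open>The permutations are sorted by their exact agreement set \<open>A\<close> in
  \<open>D\<close>. Each of the \<open>card D choose g\<close> sets contributes equally, since the
  count depends on sizes only.\<close>

lemma card_agreements:
  assumes fin: "finite X" and \<beta>: "\<beta> \<in> cyclic_perms X" and D: "D \<subseteq> X"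
  shows "card {\<sigma> \<in> cyclic_perms X. card {x \<in> D. \<sigma> x = \<beta> x} = g}
    = (card D choose g) * avoid_count (card X - g) (card D - g)"
proof -
  have finD: "finite D" using finite_subset[OF D fin] .
  let ?W = "\<lambda>A. {\<sigma> \<in> cyclic_perms X. (\<forall>x\<in>A. \<sigma> x = \<beta> x) \<and> (\<forall>x\<in>D - A. \<sigma> x \<noteq> \<beta> x)}"
  let ?\<A> = "{A. A \<subseteq> D \<and> card A = g}"
  have W_iff: "\<sigma> \<in> ?W A \<longleftrightarrow> \<sigma> \<in> cyclic_perms X \<and> {x \<in> D. \<sigma> x = \<beta> x} = A" if "A \<subseteq> D" for \<sigma> A
    using that by auto
  have "{\<sigma> \<in> cyclic_perms X. card {x \<in> D. \<sigma> x = \<beta> x} = g} = (\<Union>A\<in>?\<A>. ?W A)" (is "?L = ?R")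
  proof (intro equalityI subsetI)
    fix \<sigma> assume \<sigma>: "\<sigma> \<in> ?L"
    then have "\<sigma> \<in> ?W {x \<in> D. \<sigma> x = \<beta> x}" by simp
    moreover have "{x \<in> D. \<sigma> x = \<beta> x} \<in> ?\<A>" using \<sigma> by auto
    ultimately show "\<sigma> \<in> ?R" by (rule UN_I[rotated])
  next
    fix \<sigma> assume "\<sigma> \<in> ?R"
    then obtain A where A: "A \<subseteq> D" "card A = g" "\<sigma> \<in> ?W A" by blast
    then show "\<sigma> \<in> ?L" using W_iff[OF A(1), of \<sigma>] by simp
  qed
  also have "card \<dots> = (\<Sum>A\<in>?\<A>. card (?W A))"
  proof (rule card_UN_disjoint)
    show "finite ?\<A>" using finD by simp
    show "\<forall>A\<in>?\<A>. finite (?W A)" using finite_cyclic_perms[OF fin] by simp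
    show "\<forall>A\<in>?\<A>. \<forall>A'\<in>?\<A>. A \<noteq> A' \<longrightarrow> ?W A \<inter> ?W A' = {}"
    proof (intro ballI impI equals0I)
      fix A A' \<sigma> assume A: "A \<in> ?\<A>" "A' \<in> ?\<A>" "A \<noteq> A'" and \<sigma>: "\<sigma> \<in> ?W A \<inter> ?W A'"
      then have "{x \<in> D. \<sigma> x = \<beta> x} = A" using W_iff[of A \<sigma>] by simp
      moreover have "{x \<in> D. \<sigma> x = \<beta> x} = A'" using W_iff[of A' \<sigma>] A \<sigma> by simp
      ultimately show False using A by simp
    qed
  qed
  also have "\<dots> = (\<Sum>A\<in>?\<A>. avoid_count (card X - g) (card D - g))"
  proof (rule sum.cong)
    fix A assume A: "A \<in> ?\<A>"
    then have "card (?W A) = avoid_count (card X - card A) (card (D - A))"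
      by (intro card_agree_disagree[OF fin \<beta>]) (use finD D in auto)
    then show "card (?W A) = avoid_count (card X - g) (card D - g)"
      using A finD by (auto simp: card_Diff_subset finite_subset)
  qed simp
  also have "\<dots> = (card D choose g) * avoid_count (card X - g) (card D - g)"
    using n_subsets[OF finD] by simp
  finally show ?thesis .
qed

subsection \<open>Conjugates of a cyclic permutation\<close>

lemma conj_funpow:
  assumes "\<alpha> permutes X"
  shows "((\<alpha> \<circ> \<beta> \<circ> inv \<alpha>) ^^ i) (\<alpha> a) = \<alpha> ((\<beta> ^^ i) a)"
  using permutes_inverses[OF assms] by (induction i) simp_all

lemma conj_cyclic_perms:
  assumes \<alpha>: "\<alpha> permutes X" and \<beta>: "\<beta> \<in> cyclic_perms X"
  shows "\<alpha> \<circ> \<beta> \<circ> inv \<alpha> \<in> cyclic_perms X"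
proof (rule cyclic_permsI)
  show "\<alpha> \<circ> \<beta> \<circ> inv \<alpha> permutes X"
    using \<alpha> cyclic_perms_permutes[OF \<beta>] by (intro permutes_compose permutes_inv)
  fix a b assume "a \<in> X" "b \<in> X"
  then have "inv \<alpha> a \<in> X" "inv \<alpha> b \<in> X" using permutes_in_image[OF permutes_inv[OF \<alpha>]] by auto
  then obtain i where "(\<beta> ^^ i) (inv \<alpha> a) = inv \<alpha> b" using cyclic_perms_reach[OF \<beta>] by blast
  then have "((\<alpha> \<circ> \<beta> \<circ> inv \<alpha>) ^^ i) a = b"
    using conj_funpow[OF \<alpha>, of i \<beta> "inv \<alpha> a"] permutes_inverses[OF \<alpha>] by simp
  then show "\<exists>i. ((\<alpha> \<circ> \<beta> \<circ> inv \<alpha>) ^^ i) a = b" by blast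
qed

text \<open>Injectivity: \<alpha> is recovered along the orbit of \<open>q\<close>, because
  \<open>\<alpha> ((\<beta> ^^ i) q)\<close> is the \<open>i\<close>-th iterate of the conjugate at
  \<open>\<alpha> q\<close>. Surjectivity follows by counting: \<open>card X\<close> values times
  \<open>fact (card X - 1)\<close> cyclic permutations is the number of permutations of
  \<open>X\<close>.\<close>

lemma bij_betw_conj:
  assumes fin: "finite X" and \<beta>: "\<beta> \<in> cyclic_perms X" and q: "q \<in> X"
  shows "bij_betw (\<lambda>\<alpha>. (\<alpha> q, \<alpha> \<circ> \<beta> \<circ> inv \<alpha>)) {\<alpha>. \<alpha> permutes X} (X \<times> cyclic_perms X)"
    (is "bij_betw ?f ?P ?T")
proof -
  have inj: "inj_on ?f ?P"
  proof (rule inj_onI)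
    fix \<alpha> \<alpha>' assume P: "\<alpha> \<in> ?P" "\<alpha>' \<in> ?P" and eq: "?f \<alpha> = ?f \<alpha>'"
    show "\<alpha> = \<alpha>'"
    proof (rule permutes_eqI[of _ X])
      fix x assume "x \<in> X"
      then obtain i where x: "(\<beta> ^^ i) q = x" using cyclic_perms_reach[OF \<beta> q] by blast
      have "\<alpha> x = ((\<alpha> \<circ> \<beta> \<circ> inv \<alpha>) ^^ i) (\<alpha> q)" using conj_funpow[of \<alpha> X i \<beta> q] P x by simp
      also have "\<dots> = ((\<alpha>' \<circ> \<beta> \<circ> inv \<alpha>') ^^ i) (\<alpha>' q)" using eq by simp
      also have "\<dots> = \<alpha>' x" using conj_funpow[of \<alpha>' X i \<beta> q] P x by simp
      finally show "\<alpha> x = \<alpha>' x" .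
    qed (use P in auto)
  qed
  have sub: "?f ` ?P \<subseteq> ?T"
    using conj_cyclic_perms[OF _ \<beta>] permutes_in_image q by fastforce
  have pos: "card X > 0" using q fin card_gt_0_iff by blast
  have "card (cyclic_perms X) = fact (card X - 1)"
    using card_agree[OF fin \<beta>, of "{}"] by simp
  then have "card ?T = fact (card X)"
    using pos by (simp add: card_cartesian_product fact_reduce)
  moreover have "card (?f ` ?P) = fact (card X)"
    using card_image[OF inj] card_permutations[OF refl fin] by simp
  moreover have "finite ?T" using fin finite_cyclic_perms[OF fin] by simp
  ultimately have "?f ` ?P = ?T" using card_subset_eq[OF _ sub] by simp
  then show ?thesis using inj by (simp add: bij_betw_def)
qed

text \<open>With the value at \<open>q\<close> fixed, conjugation runs through every cyclic
  permutation exactly once, so questions about \<alpha> become questions about a cyclic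
  \<sigma>.\<close>

lemma card_conj:
  assumes fin: "finite X" and \<beta>: "\<beta> \<in> cyclic_perms X" and q: "q \<in> X" and p: "p \<in> X"
  shows "card {\<alpha>. \<alpha> permutes X \<and> \<alpha> q = p \<and> Q (\<alpha> \<circ> \<beta> \<circ> inv \<alpha>)} = card {\<sigma> \<in> cyclic_perms X. Q \<sigma>}"
    (is "card ?A = card ?B")
proof -
  let ?f = "\<lambda>\<alpha>. (\<alpha> q, \<alpha> \<circ> \<beta> \<circ> inv \<alpha>)"
  note bij = bij_betw_conj[OF fin \<beta> q]
  have "bij_betw ?f ?A ({p} \<times> ?B)"
  proof (rule bij_betw_subset[OF bij])
    show "?f ` ?A = {p} \<times> ?B"
    proof (intro equalityI subsetI)
      fix z assume z: "z \<in> {p} \<times> ?B"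
      then have "z \<in> ?f ` {\<alpha>. \<alpha> permutes X}"
        using p bij by (auto simp: bij_betw_def)
      then show "z \<in> ?f ` ?A" using z by auto
    qed (use conj_cyclic_perms[OF _ \<beta>] in auto)
  qed auto
  then show ?thesis using bij_betw_same_card[of ?f ?A] by (simp add: card_cartesian_product)
qed

lemma conj_agreements:
  assumes \<alpha>: "\<alpha> permutes X"
  shows "card {a \<in> X. \<alpha> (\<beta> a) = \<beta> (\<alpha> a)} = card {x \<in> X. (\<alpha> \<circ> \<beta> \<circ> inv \<alpha>) x = \<beta> x}"
proof -
  have "{x \<in> X. (\<alpha> \<circ> \<beta> \<circ> inv \<alpha>) x = \<beta> x} = \<alpha> ` {a \<in> X. \<alpha> (\<beta> a) = \<beta> (\<alpha> a)}"
  proof (intro equalityI subsetI)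
    fix x assume x: "x \<in> {x \<in> X. (\<alpha> \<circ> \<beta> \<circ> inv \<alpha>) x = \<beta> x}"
    then have "inv \<alpha> x \<in> {a \<in> X. \<alpha> (\<beta> a) = \<beta> (\<alpha> a)}"
      using permutes_in_image[OF permutes_inv[OF \<alpha>]] permutes_inverses[OF \<alpha>] by simp
    moreover have "x = \<alpha> (inv \<alpha> x)" using permutes_inverses[OF \<alpha>] by simp
    ultimately show "x \<in> \<alpha> ` {a \<in> X. \<alpha> (\<beta> a) = \<beta> (\<alpha> a)}" by blast
  qed (use permutes_in_image[OF \<alpha>] permutes_inverses[OF \<alpha>] in auto)
  then show ?thesis
    by (simp add: card_image permutes_inj_on[OF \<alpha>])
qed

text \<open>In general \<alpha> need not map \<open>inv \<beta> q\<close> to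
  \<open>inv \<beta> (\<alpha> q)\<close>. At a point where \<alpha> and \<beta> commute, however,
  being the first is equivalent to having the second as image, so excluding them removes
  corresponding agreements.\<close>

lemma conj_agreements_except:
  assumes \<alpha>: "\<alpha> permutes X" and \<beta>: "\<beta> permutes X"
  shows "card {a \<in> X - {q, inv \<beta> q}. \<alpha> (\<beta> a) = \<beta> (\<alpha> a)}
    = card {x \<in> X - {\<alpha> q, inv \<beta> (\<alpha> q)}. (\<alpha> \<circ> \<beta> \<circ> inv \<alpha>) x = \<beta> x}" (is "card ?A = card ?B")
proof -
  note inv\<alpha> = permutes_inverses[OF \<alpha>] and inv\<beta> = permutes_inverses[OF \<beta>]
  have iff: "\<alpha> a \<in> ?B \<longleftrightarrow> a \<in> ?A" for a
  proof -
    have "\<alpha> a = \<alpha> q \<longleftrightarrow> a = q" using inv\<alpha> by metis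
    moreover have "\<alpha> a = inv \<beta> (\<alpha> q) \<longleftrightarrow> a = inv \<beta> q" if "\<alpha> (\<beta> a) = \<beta> (\<alpha> a)"
      using inv\<alpha> inv\<beta> that by metis
    ultimately show ?thesis using permutes_in_image[OF \<alpha>] inv\<alpha> by auto
  qed
  have "?B = \<alpha> ` ?A"
  proof (intro equalityI subsetI)
    fix x assume "x \<in> ?B"
    then have "inv \<alpha> x \<in> ?A" using iff[of "inv \<alpha> x"] inv\<alpha> by simp
    moreover have "x = \<alpha> (inv \<alpha> x)" using inv\<alpha> by simp
    ultimately show "x \<in> \<alpha> ` ?A" by blast
  next
    fix x assume "x \<in> \<alpha> ` ?A"
    then show "x \<in> ?B" using iff by (elim imageE) (simp only:)
  qed
  then show ?thesis by (simp add: card_image permutes_inj_on[OF \<alpha>])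
qed

subsection \<open>The numbers $C(k)$ and $S(j)$\<close>

lemma cycle_of_list_cyclic_perms:
  assumes "distinct cs"
  shows "cycle_of_list cs \<in> cyclic_perms (set cs)"
proof (rule cyclic_permsI[OF cycle_permutes])
  let ?c = "cycle_of_list cs" and ?l = "length cs"
  fix a b assume "a \<in> set cs" "b \<in> set cs"
  then obtain i j where ij: "i < ?l" "j < ?l" "a = cs ! i" "b = cs ! j" by (metis in_set_conv_nth)
  \<comment> \<open>Powers of the cycle rotate the list; the added full turn keeps the exponent
    correct when \<open>j < i\<close>.\<close>
  let ?n = "?l - i + j"
  have "(?c ^^ ?n) a = map (?c ^^ ?n) cs ! i" using ij by simp
  also have "\<dots> = rotate ?n cs ! i" using cyclic_rotation[OF assms] by simp
  also have "\<dots> = cs ! ((?n + i) mod ?l)" using ij by (simp add: nth_rotate add.commute)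
  also have "(?n + i) mod ?l = j" using ij by simp
  finally show "\<exists>i. (?c ^^ i) a = b" using ij by blast
qed

lemma cyclic_perms_imp_cycle_of_list:
  assumes fin: "finite X" and \<sigma>: "\<sigma> \<in> cyclic_perms X"
  shows "\<exists>cs. distinct cs \<and> set cs = X \<and> \<sigma> = cycle_of_list cs"
proof (cases "X = {}")
  case True
  then show ?thesis using \<sigma> by (intro exI[of _ "[]"]) (simp add: cyclic_perms_empty)
next
  case False
  then obtain a where a: "a \<in> X" by blast
  note p = cyclic_perms_permutes[OF \<sigma>]
  have perm: "permutation \<sigma>" using p fin permutation_permutes by blast
  \<comment> \<open>The list is the orbit of \<open>a\<close> in order of visit, which exhausts
    \<open>X\<close> by transitivity.\<close>
  define cs where "cs = support \<sigma> a"
  have dist: "distinct cs" unfolding cs_def by (rule cycle_of_permutation[OF perm])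
  have set: "set cs = X"
    unfolding cs_def support_set[OF perm]
    using cyclic_perms_reach[OF \<sigma> a] permutes_in_image[OF permutes_funpow[OF p]] a by blast
  have "\<sigma> = cycle_of_list cs"
  proof (rule permutes_eqI[OF p])
    show "cycle_of_list cs permutes X" using cycle_permutes[of cs] set by simp
    show "\<sigma> x = cycle_of_list cs x" if "x \<in> X" for x
      using cycle_restrict[OF perm, of x a] that set by (simp add: cs_def)
  qed
  with dist set show ?thesis by blast
qed

lemma is_cycle_iff: "is_cycle n m \<sigma> \<longleftrightarrow> (\<exists>X \<subseteq> {1..n}. card X = m \<and> \<sigma> \<in> cyclic_perms X)"
proof
  assume "is_cycle n m \<sigma>"
  then show "\<exists>X \<subseteq> {1..n}. card X = m \<and> \<sigma> \<in> cyclic_perms X"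
    unfolding is_cycle_def using cycle_of_list_cyclic_perms distinct_card by metis
next
  assume "\<exists>X \<subseteq> {1..n}. card X = m \<and> \<sigma> \<in> cyclic_perms X"
  then obtain X where X: "X \<subseteq> {1..n}" "card X = m" "\<sigma> \<in> cyclic_perms X" by blast
  then have "finite X" using finite_subset by blast
  from cyclic_perms_imp_cycle_of_list[OF this X(3)] show "is_cycle n m \<sigma>"
    unfolding is_cycle_def using X distinct_card by metis
qed

lemma is_cycle_full_iff: "is_cycle k k \<sigma> \<longleftrightarrow> \<sigma> \<in> cyclic_perms {1..k}"
proof -
  have "X = {1..k}" if "X \<subseteq> {1..k}" "card X = k" for X
    using card_subset_eq[of "{1..k}" X] that by simp
  then show ?thesis unfolding is_cycle_iff by (metis card_atLeastAtMost diff_Suc_1 order_refl)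
qed

text \<open>The starting point \<open>a\<close> is kept general: $C(k)$ needs the shift of
  \<open>{1..k}\<close>, and $S(j)$ that of \<open>{0..j}\<close>.\<close>

lemma ex_cyclic_shift:
  obtains \<beta> :: "nat \<Rightarrow> nat" where "\<beta> \<in> cyclic_perms {a..<a + k}" "\<And>i. i < k \<Longrightarrow> \<beta> (a + i) = a + Suc i mod k"
proof (rule that)
  let ?cs = "[a..<a + k]"
  show "cycle_of_list ?cs \<in> cyclic_perms {a..<a + k}"
    using cycle_of_list_cyclic_perms[of ?cs] by simp
  fix i assume i: "i < k"
  have "cycle_of_list ?cs (a + i) = map (cycle_of_list ?cs) ?cs ! i" using i by simp
  also have "map (cycle_of_list ?cs) ?cs = rotate 1 ?cs"
    using cyclic_rotation[of ?cs 1] by simp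
  also have "rotate 1 ?cs ! i = a + Suc i mod k" using i nth_rotate[of i ?cs 1] by simp
  finally show "cycle_of_list ?cs (a + i) = a + Suc i mod k" .
qed

text \<open>No value is prescribed and disagreement with the shift is demanded everywhere; at
  \<open>k = 0\<close> truncation in \<open>avoid_count\<close> yields the conventional 1.\<close>

lemma cyclic_succession_free_count_eq: "cyclic_succession_free_count k = avoid_count k k"
proof -
  obtain \<beta> :: "nat \<Rightarrow> nat" where "\<beta> \<in> cyclic_perms {1..<1 + k}"
    and shift: "\<And>i. i < k \<Longrightarrow> \<beta> (1 + i) = 1 + Suc i mod k"
    using ex_cyclic_shift[of 1 k] by metis
  then have \<beta>: "\<beta> \<in> cyclic_perms {1..k}" by (simp add: atLeastLessThanSuc_atLeastAtMost)
  have "\<beta> i = i mod k + 1" if "i \<in> {1..k}" for i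
    using shift[of "i - 1"] that by (cases i) auto
  then have "cyclic_succession_free_count k = card {\<sigma> \<in> cyclic_perms {1..k}. \<forall>i\<in>{1..k}. \<sigma> i \<noteq> \<beta> i}"
    unfolding cyclic_succession_free_count_def is_cycle_full_iff by (intro arg_cong[of _ _ card]) auto
  also have "\<dots> = avoid_count k k"
    using card_agree_disagree[OF _ \<beta>, of "{1..k}" "{}"] by simp
  finally show ?thesis .
qed

text \<open>The permutation fixing the extra point \<open>0\<close> is read as the cycle obtained by conjugating
  \<open>(0 1 \<dots> j)\<close>; the points \<open>0\<close> and \<open>j\<close> carry no condition.\<close>

lemma succession_free_count_eq:
  assumes "j \<ge> 1"
  shows "succession_free_count j = avoid_count (j + 1) (j - 1)"
proof -
  let ?X = "{0..j}" and ?D = "{1..<j}"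
  obtain \<beta> :: "nat \<Rightarrow> nat" where "\<beta> \<in> cyclic_perms {0..<0 + Suc j}"
    and shift: "\<And>i. i < Suc j \<Longrightarrow> \<beta> (0 + i) = 0 + Suc i mod Suc j"
    using ex_cyclic_shift[of 0 "Suc j"] by metis
  then have \<beta>: "\<beta> \<in> cyclic_perms ?X" by (simp add: atLeastLessThanSuc_atLeastAtMost)
  note p = cyclic_perms_permutes[OF \<beta>]
  have \<beta>_eq: "\<beta> i = (if i = j then 0 else Suc i)" if "i \<le> j" for i
    using shift[of i] that by simp
  have inv0: "inv \<beta> 0 = j" using \<beta>_eq[of j] permutes_inverses[OF p] by (metis le_refl)
  have sub: "?D \<subseteq> ?X" by auto
  have D: "?X - {0, inv \<beta> 0} = ?D" using inv0 by auto
  have "\<not> (\<exists>i. 1 \<le> i \<and> i < j \<and> \<alpha> (i + 1) = \<alpha> i + 1) \<longleftrightarrow>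
      (\<forall>x\<in>?D. (\<alpha> \<circ> \<beta> \<circ> inv \<alpha>) x \<noteq> \<beta> x)"
    if \<alpha>: "\<alpha> permutes ?X" "\<alpha> 0 = 0" for \<alpha>
  proof -
    have le: "\<alpha> i \<le> j" if "i \<le> j" for i using permutes_in_image[OF \<alpha>(1), of i] that by simp
    \<comment> \<open>This settles the wrap-around: if \<open>\<alpha> i = j\<close>, then
      \<open>\<beta> (\<alpha> i) = 0\<close> is not a value of \<alpha> at \<open>Suc i\<close>,
      and there is no succession at \<open>i\<close> either.\<close>
    have nz: "\<alpha> (Suc i) \<noteq> 0" for i using permutes_inj[OF \<alpha>(1)] \<alpha>(2) by (metis injD nat.distinct(1))
    have "\<alpha> (\<beta> i) = \<beta> (\<alpha> i) \<longleftrightarrow> \<alpha> (i + 1) = \<alpha> i + 1" if "i \<in> ?D" for i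
      using that \<beta>_eq[of i] \<beta>_eq[of "\<alpha> i"] le[of i] le[of "Suc i"] nz[of i] by (auto split: if_splits)
    then have "\<not> (\<exists>i. 1 \<le> i \<and> i < j \<and> \<alpha> (i + 1) = \<alpha> i + 1) \<longleftrightarrow> {a \<in> ?D. \<alpha> (\<beta> a) = \<beta> (\<alpha> a)} = {}"
      by auto
    also have "\<dots> \<longleftrightarrow> card {a \<in> ?D. \<alpha> (\<beta> a) = \<beta> (\<alpha> a)} = 0" by simp
    also have "\<dots> \<longleftrightarrow> card {x \<in> ?D. (\<alpha> \<circ> \<beta> \<circ> inv \<alpha>) x = \<beta> x} = 0"
      using conj_agreements_except[OF \<alpha>(1) p, of 0] unfolding \<alpha>(2) D by simp
    finally show ?thesis by auto
  qed
  moreover have "p permutes {1..j} \<longleftrightarrow> p permutes ?X \<and> p 0 = 0" for p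
  proof -
    have "p permutes ?X" if "p permutes {1..j}" using permutes_subset[OF that] by auto
    moreover have "p permutes {1..j}" if "p permutes ?X" "p 0 = 0"
      by (rule permutes_superset[OF that(1)]) (use that(2) in \<open>auto simp: Suc_le_eq\<close>)
    moreover have "p 0 = 0" if "p permutes {1..j}" using permutes_not_in[OF that] by simp
    ultimately show ?thesis by blast
  qed
  ultimately have "{p. p permutes {1..j} \<and> \<not> (\<exists>i. 1 \<le> i \<and> i < j \<and> p (i + 1) = p i + 1)}
    = {\<alpha>. \<alpha> permutes ?X \<and> \<alpha> 0 = 0 \<and> (\<forall>x\<in>?D. (\<alpha> \<circ> \<beta> \<circ> inv \<alpha>) x \<noteq> \<beta> x)}"
    by blast
  then have "succession_free_count j = card {\<sigma> \<in> cyclic_perms ?X. \<forall>x\<in>?D. \<sigma> x \<noteq> \<beta> x}"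
    unfolding succession_free_count_def
    using card_conj[OF _ \<beta>, of 0 0 "\<lambda>\<sigma>. \<forall>x\<in>?D. \<sigma> x \<noteq> \<beta> x"] by simp
  also have "\<dots> = avoid_count (j + 1) (j - 1)"
    using card_agree_disagree[OF _ \<beta> _ _ sub, of "{}"] by simp
  finally show ?thesis .
qed

subsection \<open>Commutation with an $(n-1)$-cycle\<close>

lemma card_permutes_by_value:
  assumes fin: "finite X" and q: "q \<in> X"
  shows "card {\<alpha>. \<alpha> permutes X \<and> Q \<alpha>} = (\<Sum>p\<in>X. card {\<alpha>. \<alpha> permutes X \<and> \<alpha> q = p \<and> Q \<alpha>})"
proof -
  have "{\<alpha>. \<alpha> permutes X \<and> Q \<alpha>} = (\<Union>p\<in>X. {\<alpha>. \<alpha> permutes X \<and> \<alpha> q = p \<and> Q \<alpha>})"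
    using q by (auto simp: permutes_in_image)
  also have "card \<dots> = (\<Sum>p\<in>X. card {\<alpha>. \<alpha> permutes X \<and> \<alpha> q = p \<and> Q \<alpha>})"
  proof (rule card_UN_disjoint[OF fin])
    show "\<forall>p\<in>X. finite {\<alpha>. \<alpha> permutes X \<and> \<alpha> q = p \<and> Q \<alpha>}"
      using finite_permutations[OF fin] by simp
  qed auto
  finally show ?thesis .
qed

lemma permutes_insert_fixed_iff:
  assumes "f \<notin> X"
  shows "\<alpha> permutes insert f X \<and> \<alpha> f = f \<longleftrightarrow> \<alpha> permutes X"
proof
  assume "\<alpha> permutes insert f X \<and> \<alpha> f = f"
  then show "\<alpha> permutes X" using permutes_superset[of \<alpha> "insert f X" X] by auto
next
  assume \<alpha>: "\<alpha> permutes X"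
  then show "\<alpha> permutes insert f X \<and> \<alpha> f = f"
    using permutes_subset[OF \<alpha> subset_insertI] permutes_not_in[OF \<alpha> assms] by simp
qed

text \<open>The common fixed point \<open>f\<close> is always an agreement, hence the
  \<open>Suc\<close>. The factor \<open>card X\<close> is the free choice of the value at an
  auxiliary point \<open>q\<close>.\<close>

lemma card_agreements_fixing:
  assumes fin: "finite X" and \<beta>: "\<beta> \<in> cyclic_perms X" and f: "f \<notin> X" and "X \<noteq> {}"
  shows "card {\<alpha>. \<alpha> permutes insert f X \<and> \<alpha> f = f \<and> card {a \<in> insert f X. \<alpha> (\<beta> a) = \<beta> (\<alpha> a)} = g}
    = card X * card {\<sigma> \<in> cyclic_perms X. Suc (card {x \<in> X. \<sigma> x = \<beta> x}) = g}"
proof -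
  obtain q where q: "q \<in> X" using assms(4) by blast
  have \<beta>f: "\<beta> f = f" using permutes_not_in[OF cyclic_perms_permutes[OF \<beta>] f] .
  have agr: "card {a \<in> insert f X. \<alpha> (\<beta> a) = \<beta> (\<alpha> a)} = Suc (card {x \<in> X. (\<alpha> \<circ> \<beta> \<circ> inv \<alpha>) x = \<beta> x})"
    if \<alpha>: "\<alpha> permutes X" for \<alpha>
  proof -
    have "{a \<in> insert f X. \<alpha> (\<beta> a) = \<beta> (\<alpha> a)} = insert f {a \<in> X. \<alpha> (\<beta> a) = \<beta> (\<alpha> a)}"
      using \<beta>f permutes_not_in[OF \<alpha> f] by auto
    then show ?thesis using fin f conj_agreements[OF \<alpha>, of \<beta>] by simp
  qed
  have "{\<alpha>. \<alpha> permutes insert f X \<and> \<alpha> f = f \<and> card {a \<in> insert f X. \<alpha> (\<beta> a) = \<beta> (\<alpha> a)} = g}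
    = {\<alpha>. \<alpha> permutes X \<and> Suc (card {x \<in> X. (\<alpha> \<circ> \<beta> \<circ> inv \<alpha>) x = \<beta> x}) = g}"
    unfolding conj_assoc[symmetric] permutes_insert_fixed_iff[OF f]
    by (rule Collect_cong, rule conj_cong[OF refl]) (simp only: agr)
  then show ?thesis
    using card_permutes_by_value[OF fin q, of "\<lambda>\<alpha>. Suc (card {x \<in> X. (\<alpha> \<circ> \<beta> \<circ> inv \<alpha>) x = \<beta> x}) = g"]
      card_conj[OF fin \<beta> q, of _ "\<lambda>\<sigma>. Suc (card {x \<in> X. \<sigma> x = \<beta> x}) = g"]
    by simp
qed

text \<open>The transposition exchanges the values at \<open>f\<close> and \<open>q\<close>, which
  inserts \<open>f\<close> into the cycle of \<alpha> between \<open>q\<close> and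
  \<open>\<alpha> q\<close>. Conversely, \<open>q\<close> is the preimage of \<open>f\<close>, and
  the same transposition takes \<open>f\<close> out again.\<close>

lemma bij_betw_permutes_moving:
  assumes f: "f \<notin> X"
  shows "bij_betw (\<lambda>(q, \<alpha>). transpose f (\<alpha> q) \<circ> \<alpha>) (X \<times> {\<alpha>. \<alpha> permutes X})
    {\<alpha>. \<alpha> permutes insert f X \<and> \<alpha> f \<noteq> f}"
proof (rule bij_betw_byWitness[where f' = "\<lambda>\<alpha>. (inv \<alpha> f, transpose f (\<alpha> f) \<circ> \<alpha>)"])
  let ?g = "\<lambda>(q, \<alpha>). transpose f (\<alpha> q) \<circ> \<alpha>" and ?h = "\<lambda>\<alpha>. (inv \<alpha> f, transpose f (\<alpha> f) \<circ> \<alpha>)"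
  let ?P = "X \<times> {\<alpha>. \<alpha> permutes X}" and ?R = "{\<alpha>. \<alpha> permutes insert f X \<and> \<alpha> f \<noteq> f}"
  have g: "?g (q, \<alpha>) \<in> ?R" "?g (q, \<alpha>) f = \<alpha> q" "?g (q, \<alpha>) q = f" if "q \<in> X" "\<alpha> permutes X" for q \<alpha>
  proof -
    have \<alpha>: "\<alpha> permutes insert f X" "\<alpha> f = f" "\<alpha> q \<in> X"
      using that permutes_insert_fixed_iff[OF f] permutes_in_image by metis+
    then show "?g (q, \<alpha>) f = \<alpha> q" "?g (q, \<alpha>) q = f" by simp_all
    have "transpose f (\<alpha> q) permutes insert f X" using \<alpha> by (intro permutes_swap_id) auto
    then show "?g (q, \<alpha>) \<in> ?R" using \<alpha> f by (auto intro: permutes_compose)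
  qed
  show "\<forall>z\<in>?P. ?h (?g z) = z"
  proof
    fix z assume "z \<in> ?P"
    then obtain q \<alpha> where z: "q \<in> X" "\<alpha> permutes X" and z_eq: "z = (q, \<alpha>)" by auto
    then have "inv (?g (q, \<alpha>)) f = q" using g by (metis (lifting) mem_Collect_eq permutes_inverses(2))
    moreover have "transpose f (?g (q, \<alpha>) f) \<circ> ?g (q, \<alpha>) = \<alpha>"
      unfolding g(2)[OF z] by (simp add: fun_eq_iff)
    ultimately show "?h (?g z) = z" by (simp add: z_eq)
  qed
  show "?g ` ?P \<subseteq> ?R" using g(1) by blast
  show "\<forall>\<alpha>\<in>?R. ?g (?h \<alpha>) = \<alpha>"
  proof
    fix \<alpha> assume "\<alpha> \<in> ?R"
    then have "\<alpha> (inv \<alpha> f) = f" using permutes_inverses(1)[of \<alpha> "insert f X"] by simp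
    then show "?g (?h \<alpha>) = \<alpha>" by (simp add: fun_eq_iff)
  qed
  show "?h ` ?R \<subseteq> ?P"
  proof (rule image_subsetI)
    fix \<alpha> assume "\<alpha> \<in> ?R"
    then have \<alpha>: "\<alpha> permutes insert f X" "\<alpha> f \<noteq> f" by simp_all
    have "\<alpha> (inv \<alpha> f) = f" using permutes_inverses(1)[OF \<alpha>(1)] .
    moreover have "inv \<alpha> f \<in> insert f X" using permutes_in_image[OF permutes_inv[OF \<alpha>(1)]] by simp
    ultimately have "inv \<alpha> f \<in> X" using \<alpha>(2) by auto
    moreover have "transpose f (\<alpha> f) permutes insert f X"
      using permutes_in_image[OF \<alpha>(1), of f] by (intro permutes_swap_id) auto
    then have "transpose f (\<alpha> f) \<circ> \<alpha> permutes X"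
      using permutes_insert_fixed_iff[OF f, of "transpose f (\<alpha> f) \<circ> \<alpha>"] permutes_compose[OF \<alpha>(1)] by simp
    ultimately show "?h \<alpha> \<in> ?P" by simp
  qed
qed

text \<open>The points \<open>f\<close>, \<open>q\<close> and \<open>\<beta>\<inverse> q\<close> always violate commutation with \<open>\<gamma>\<close>.\<close>

lemma agreements_moving:
  assumes fin: "finite X" and \<beta>: "\<beta> \<in> cyclic_perms X" and f: "f \<notin> X" and X: "card X \<ge> 2"
    and \<alpha>: "\<alpha> permutes X" and q: "q \<in> X"
  defines "\<gamma> \<equiv> transpose f (\<alpha> q) \<circ> \<alpha>"
  shows "{a \<in> insert f X. \<gamma> (\<beta> a) = \<beta> (\<gamma> a)} = {a \<in> X - {q, inv \<beta> q}. \<alpha> (\<beta> a) = \<beta> (\<alpha> a)}"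
proof -
  note p = cyclic_perms_permutes[OF \<beta>]
  note inv\<beta> = permutes_inverses[OF p]
  have no_fix: "\<beta> x \<noteq> x" if "x \<in> X" for x using cyclic_perms_no_fixpoint[OF \<beta> that fin X] .
  have \<beta>f: "\<beta> f = f" and \<alpha>f: "\<alpha> f = f" using permutes_not_in[OF p f] permutes_not_in[OF \<alpha> f] .
  have \<alpha>X: "\<alpha> x \<in> X" and \<beta>X: "\<beta> x \<in> X" if "x \<in> X" for x
    using that permutes_in_image[OF p] permutes_in_image[OF \<alpha>] by auto
  have \<alpha>_inj: "\<alpha> x = \<alpha> y \<longleftrightarrow> x = y" for x y using permutes_inj[OF \<alpha>] by (auto dest: injD)
  have \<gamma>f: "\<gamma> f = \<alpha> q" and \<gamma>q: "\<gamma> q = f" by (simp_all add: \<gamma>_def \<alpha>f)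
  have \<gamma>: "\<gamma> x = \<alpha> x" if "x \<in> X" "x \<noteq> q" for x
  proof -
    have "\<alpha> x \<noteq> f" "\<alpha> x \<noteq> \<alpha> q" using that f \<alpha>X[of x] \<alpha>_inj by auto
    then show ?thesis by (simp add: \<gamma>_def)
  qed
  \<comment> \<open>At \<open>f\<close> agreement would make \<open>\<alpha> q\<close> a fixed point
    of \<beta>. At \<open>q\<close> and at \<open>inv \<beta> q\<close> exactly one of the two sides
    equals \<open>f\<close>, while the other lies in \<open>X\<close>.\<close>
  have "\<gamma> (\<beta> f) \<noteq> \<beta> (\<gamma> f)" using \<beta>f \<gamma>f no_fix[OF \<alpha>X[OF q]] by simp
  moreover have "\<gamma> (\<beta> q) \<noteq> \<beta> (\<gamma> q)"
    using \<gamma>[OF \<beta>X[OF q] no_fix[OF q]] \<alpha>X[OF \<beta>X[OF q]] \<beta>f f by (auto simp: \<gamma>q)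
  moreover have "\<gamma> (\<beta> a) \<noteq> \<beta> (\<gamma> a)" if "a = inv \<beta> q" "a \<in> X" for a
  proof -
    have "\<beta> a = q" using that inv\<beta> by simp
    moreover have "a \<noteq> q" using no_fix[OF that(2)] \<open>\<beta> a = q\<close> by auto
    then have "\<gamma> a = \<alpha> a" using \<gamma> that by simp
    ultimately show ?thesis using \<gamma>q \<beta>X[OF \<alpha>X[OF that(2)]] f by auto
  qed
  moreover have "\<gamma> (\<beta> a) = \<alpha> (\<beta> a)" "\<gamma> a = \<alpha> a" if "a \<in> X" "a \<noteq> q" "a \<noteq> inv \<beta> q" for a
  proof -
    have "\<beta> a \<noteq> q" using that inv\<beta> by auto
    then show "\<gamma> (\<beta> a) = \<alpha> (\<beta> a)" "\<gamma> a = \<alpha> a" using \<gamma> \<beta>X that by simp_all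
  qed
  ultimately have "a \<in> insert f X \<and> \<gamma> (\<beta> a) = \<beta> (\<gamma> a) \<longleftrightarrow>
      a \<in> X \<and> a \<noteq> q \<and> a \<noteq> inv \<beta> q \<and> \<alpha> (\<beta> a) = \<beta> (\<alpha> a)" for a
    using f by (metis insert_iff)
  then show ?thesis by blast
qed

text \<open>The square counts the choices of the preimage \<open>q\<close> and the image
  \<open>p\<close> of \<open>f\<close>. Every such pair contributes equally, because two distinct
  points are always excluded from \<open>X\<close>.\<close>

lemma card_agreements_moving:
  assumes fin: "finite X" and \<beta>: "\<beta> \<in> cyclic_perms X" and f: "f \<notin> X" and X: "card X \<ge> 2"
  shows "card {\<alpha>. \<alpha> permutes insert f X \<and> \<alpha> f \<noteq> f \<and> card {a \<in> insert f X. \<alpha> (\<beta> a) = \<beta> (\<alpha> a)} = g}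
    = (card X)^2 * ((card X - 2 choose g) * avoid_count (card X - g) (card X - 2 - g))"
    (is "card ?S = _")
proof -
  note p = cyclic_perms_permutes[OF \<beta>]
  let ?D = "\<lambda>x. X - {x, inv \<beta> x}"
  let ?h = "\<lambda>(q, \<alpha>). transpose f (\<alpha> q) \<circ> \<alpha>"
  let ?Q = "\<lambda>q \<alpha>. card {x \<in> ?D (\<alpha> q). (\<alpha> \<circ> \<beta> \<circ> inv \<alpha>) x = \<beta> x} = g"
  let ?T = "SIGMA q:X. {\<alpha>. \<alpha> permutes X \<and> ?Q q \<alpha>}"
  have cD: "card (?D x) = card X - 2" if "x \<in> X" for x
  proof -
    have "inv \<beta> x \<in> X" using permutes_in_image[OF permutes_inv[OF p]] that by simp
    moreover have "inv \<beta> x \<noteq> x"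
      using cyclic_perms_no_fixpoint[OF \<beta> that fin X] permutes_inverses[OF p] by metis
    ultimately show ?thesis using that fin by (simp add: card_Diff_subset)
  qed
  have Q: "card {a \<in> insert f X. ?h (q, \<alpha>) (\<beta> a) = \<beta> (?h (q, \<alpha>) a)} = g \<longleftrightarrow> ?Q q \<alpha>"
    if "q \<in> X" "\<alpha> permutes X" for q \<alpha>
    using agreements_moving[OF fin \<beta> f X that(2,1)] conj_agreements_except[OF that(2) p, of q] by simp
  note bij = bij_betw_permutes_moving[OF f]
  have "bij_betw ?h ?T ?S"
  proof (rule bij_betw_subset[OF bij])
    show "?h ` ?T = ?S"
    proof (intro equalityI subsetI)
      fix \<gamma> assume "\<gamma> \<in> ?h ` ?T"
      then obtain q \<alpha> where z: "q \<in> X" "\<alpha> permutes X" "?Q q \<alpha>" "\<gamma> = ?h (q, \<alpha>)" by auto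
      then have "\<gamma> \<in> {\<alpha>. \<alpha> permutes insert f X \<and> \<alpha> f \<noteq> f}" using bij_betwE[OF bij] by blast
      then show "\<gamma> \<in> ?S" using Q[OF z(1,2)] z(3,4) by simp
    next
      fix \<gamma> assume \<gamma>: "\<gamma> \<in> ?S"
      then have "\<gamma> \<in> ?h ` (X \<times> {\<alpha>. \<alpha> permutes X})" using bij_betw_imp_surj_on[OF bij] by simp
      then obtain q \<alpha> where z: "q \<in> X" "\<alpha> permutes X" "\<gamma> = ?h (q, \<alpha>)" by auto
      then have "?Q q \<alpha>" using Q[OF z(1,2)] \<gamma> by simp
      then show "\<gamma> \<in> ?h ` ?T" using z by (intro image_eqI[of _ _ "(q, \<alpha>)"]) auto
    qed
  qed auto
  then have "card ?S = card ?T" by (rule bij_betw_same_card[symmetric])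
  also have "\<dots> = (\<Sum>q\<in>X. card {\<alpha>. \<alpha> permutes X \<and> ?Q q \<alpha>})"
    using fin finite_permutations[OF fin] by (simp add: card_SigmaI)
  also have "\<dots> = (\<Sum>q\<in>X. \<Sum>p\<in>X. (card X - 2 choose g) * avoid_count (card X - g) (card X - 2 - g))"
  proof (rule sum.cong[OF refl])
    fix q assume q: "q \<in> X"
    have "card {\<alpha>. \<alpha> permutes X \<and> ?Q q \<alpha>} = (\<Sum>p\<in>X. card {\<alpha>. \<alpha> permutes X \<and> \<alpha> q = p \<and> ?Q q \<alpha>})"
      by (rule card_permutes_by_value[OF fin q])
    also have "\<dots> = (\<Sum>p\<in>X. (card X - 2 choose g) * avoid_count (card X - g) (card X - 2 - g))"
    proof (rule sum.cong[OF refl])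
      fix p assume p: "p \<in> X"
      \<comment> \<open>Fixing \<open>\<alpha> q = p\<close> makes the excluded set independent of
        \<alpha>, so that \<open>card_conj\<close> applies.\<close>
      have "card {\<alpha>. \<alpha> permutes X \<and> \<alpha> q = p \<and> ?Q q \<alpha>}
        = card {\<alpha>. \<alpha> permutes X \<and> \<alpha> q = p \<and> card {x \<in> ?D p. (\<alpha> \<circ> \<beta> \<circ> inv \<alpha>) x = \<beta> x} = g}"
        by (rule arg_cong[of _ _ card]) auto
      also have "\<dots> = card {\<sigma> \<in> cyclic_perms X. card {x \<in> ?D p. \<sigma> x = \<beta> x} = g}"
        by (rule card_conj[OF fin \<beta> q p])
      also have "\<dots> = (card X - 2 choose g) * avoid_count (card X - g) (card X - 2 - g)"
        using card_agreements[OF fin \<beta>, of "?D p" g] cD[OF p] by simp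
      finally show "card {\<alpha>. \<alpha> permutes X \<and> \<alpha> q = p \<and> ?Q q \<alpha>} = \<dots>" .
    qed
    finally show "card {\<alpha>. \<alpha> permutes X \<and> ?Q q \<alpha>} = \<dots>" .
  qed
  also have "\<dots> = (card X)^2 * ((card X - 2 choose g) * avoid_count (card X - g) (card X - 2 - g))"
    by (simp add: power2_eq_square)
  finally show ?thesis .
qed

section \<open>From agreements back to Hamming distance\<close>

lemma k_commute_iff_agreements:
  assumes "k \<le> n"
  shows "k_commute n k \<alpha> \<beta> \<longleftrightarrow> card {a \<in> {1..n}. \<alpha> (\<beta> a) = \<beta> (\<alpha> a)} = n - k"
proof -
  let ?E = "{a \<in> {1..n}. \<alpha> (\<beta> a) = \<beta> (\<alpha> a)}"
  have "card ?E \<le> card {1..n}" by (rule card_mono) auto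
  then have "card ?E \<le> n" by simp
  moreover have "{a \<in> {1..n}. (\<alpha> \<circ> \<beta>) a \<noteq> (\<beta> \<circ> \<alpha>) a} = {1..n} - ?E" by auto
  moreover have "card ({1..n} - ?E) = card {1..n} - card ?E"
    by (rule card_Diff_subset) auto
  ultimately have "hamming n (\<alpha> \<circ> \<beta>) (\<beta> \<circ> \<alpha>) = n - card ?E" "card ?E \<le> n"
    unfolding hamming_def by simp_all
  then show ?thesis using assms by (auto simp: k_commute_def)
qed

theorem theorem3p5:
  fixes n k :: nat and \<beta> :: "nat \<Rightarrow> nat"
  assumes "n \<ge> 4"
    and "is_cycle n (n - 1) \<beta>"
    and "k \<le> n"
  shows "k_commute_count n k \<beta> =
    (n - 1) * int_binomial (int n - 1) (int k) * cyclic_succession_free_count k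
    + (n - 1)^2 * int_binomial (int n - 3) (int k - 3) * succession_free_count (k - 2)"
proof -
  obtain X where X: "X \<subseteq> {1..n}" "card X = n - 1" and \<beta>: "\<beta> \<in> cyclic_perms X"
    using assms(2) unfolding is_cycle_iff by blast
  have fin: "finite X" using X(1) finite_subset by blast
  have "card ({1..n} - X) = 1" using X assms(1) fin by (simp add: card_Diff_subset)
  then obtain f where "{1..n} - X = {f}" by (rule card_1_singletonE)
  then have f: "f \<notin> X" and ins: "{1..n} = insert f X" using X(1) by auto
  have X2: "card X - 2 = n - 3" "card X \<ge> 2" using X(2) assms(1) by auto
  have "X \<noteq> {}" using X(2) assms(1) by auto
  define E where "E \<alpha> = card {a \<in> insert f X. \<alpha> (\<beta> a) = \<beta> (\<alpha> a)}" for \<alpha>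
  let ?F = "{\<alpha>. \<alpha> permutes insert f X \<and> \<alpha> f = f \<and> E \<alpha> = n - k}"
  let ?M = "{\<alpha>. \<alpha> permutes insert f X \<and> \<alpha> f \<noteq> f \<and> E \<alpha> = n - k}"
  have "{\<alpha>. \<alpha> permutes {1..n} \<and> k_commute n k \<alpha> \<beta>} = ?F \<union> ?M"
    unfolding k_commute_iff_agreements[OF assms(3)] ins E_def by auto
  moreover have "card (?F \<union> ?M) = card ?F + card ?M"
    using finite_permutations[of "insert f X"] fin by (intro card_Un_disjoint) auto
  moreover have "card ?F = (n - 1) * int_binomial (int n - 1) (int k) * cyclic_succession_free_count k"
  proof -
    have "card ?F = (n - 1) * card {\<sigma> \<in> cyclic_perms X. Suc (card {x \<in> X. \<sigma> x = \<beta> x}) = n - k}"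
      using card_agreements_fixing[OF fin \<beta> f \<open>X \<noteq> {}\<close>, of "n - k"] X(2) by (simp add: E_def)
    also have "card {\<sigma> \<in> cyclic_perms X. Suc (card {x \<in> X. \<sigma> x = \<beta> x}) = n - k}
      = int_binomial (int n - 1) (int k) * cyclic_succession_free_count k"
    \<comment> \<open>For \<open>k = n\<close> no agreement is allowed, but \<open>f\<close> is one;
      the binomial coefficient vanishes as well.\<close>
    proof (cases "k = n")
      case True
      then show ?thesis by (simp add: int_binomial_def)
    next
      case False
      then have nk: "n - k = Suc (n - 1 - k)" "k \<le> n - 1" using assms(3) by auto
      \<comment> \<open>Here the whole of \<open>X\<close> is examined, so both arguments of
        \<open>avoid_count\<close> become \<open>k\<close>.\<close>
      have "card {\<sigma> \<in> cyclic_perms X. card {x \<in> X. \<sigma> x = \<beta> x} = n - 1 - k}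
        = (n - 1 choose (n - 1 - k)) * avoid_count k k"
        using card_agreements[OF fin \<beta> order_refl, of "n - 1 - k"]
        unfolding X(2) diff_diff_cancel[OF nk(2)] .
      also have "(n - 1 choose (n - 1 - k)) = int_binomial (int n - 1) (int k)"
        using binomial_symmetric[OF nk(2)] nk(2) assms(1) by (simp add: int_binomial_def nat_diff_distrib')
      finally show ?thesis using nk(1) by (simp add: cyclic_succession_free_count_eq)
    qed
    finally show ?thesis by simp
  qed
  moreover have "card ?M = (n - 1)^2 * int_binomial (int n - 3) (int k - 3) * succession_free_count (k - 2)"
  proof -
    have "card ?M = (n - 1)^2 * ((n - 3 choose (n - k)) * avoid_count (n - 1 - (n - k)) (n - 3 - (n - k)))"
      using card_agreements_moving[OF fin \<beta> f X2(2), of "n - k", folded E_def, unfolded X2(1), unfolded X(2)] .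
    also have "(n - 3 choose (n - k)) * avoid_count (n - 1 - (n - k)) (n - 3 - (n - k))
      = int_binomial (int n - 3) (int k - 3) * succession_free_count (k - 2)"
    \<comment> \<open>For \<open>k < 3\<close> both binomial coefficients are 0, since
      \<open>n - k\<close> exceeds \<open>n - 3\<close> and \<open>int k - 3\<close> is negative;
      the truncated \<open>k - 2\<close> is then harmless.\<close>
    proof (cases "k < 3")
      case True
      then show ?thesis using assms by (simp add: int_binomial_def binomial_eq_0)
    next
      case False
      then have "n - 3 choose (n - k) = n - 3 choose (k - 3)"
        using binomial_symmetric[of "k - 3" "n - 3"] assms by simp
      moreover have "int_binomial (int n - 3) (int k - 3) = n - 3 choose (k - 3)"
        using False assms by (simp add: int_binomial_def nat_diff_distrib')
      moreover have "n - 1 - (n - k) = k - 2 + 1" "n - 3 - (n - k) = k - 2 - 1"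
        using False assms by auto
      moreover have "succession_free_count (k - 2) = avoid_count (k - 2 + 1) (k - 2 - 1)"
        using succession_free_count_eq[of "k - 2"] False by simp
      ultimately show ?thesis by simp
    qed
    finally show ?thesis by simp
  qed
  ultimately show ?thesis by (simp add: k_commute_count_def)
qed

end
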